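(* Let $(\boldsymbol{X},Y)$ be a pair of random variables with $\boldsymbol{X}\in\mathcal{X}$ and $Y\in\{+1,-1\}$, and let $\eta(\boldsymbol{x}) := P(Y=1\mid \boldsymbol{X}=\boldsymbol{x})$. For any $\tau\in[0,1]$, the minimizer $f^*$ of $$\mathbb{E}_{\boldsymbol{X},Y}\left[\left(\frac{1+Y}{2}-\tau Y\right)\bigl(1-Y f(\boldsymbol{X})\bigr)_+\right]$$ takes the form $$f^*(\boldsymbol{x}) = \operatorname{sign}(\eta(\boldsymbol{x})-\tau).$$
   Context: The minimization is over real-valued functions $f$ on $\mathcal{X}$. Here $(t)_+ := \max(0,t)$ for $t\in\mathbb{R}$, and $\operatorname{sign}(t)=+1$ if $t\ge 0$ and $\operatorname{sign}(t)=-1$ if $t<0$, so that $\operatorname{sign}(\eta(\boldsymbol{x})-\tau)=+1$ exactly when $P(Y=1\mid\boldsymbol{X}=\boldsymbol{x})\ge\tau$. The weight $\frac{1+Y}{2}-\tau Y$ equals $1-\tau$ if $Y=+1$ and $\tau$ if $Y=-1$; the expression being minimized is the expected asymmetric hinge loss.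
   Formalization: Minimizers are not unique in general (e.g. τ=0, η=1/2, f=2), so it is shown that sign(η−τ) is a minimizer among measurable f, and that every minimizer equals it for almost every x with 0<τ<1, 0<η(x)<1 and η(x)≠τ. *)

theory Defs
  imports "HOL-Probability.Probability"
begin

text \<open>
  \<open>cond_prob_fun M N X A \<eta>\<close>: the function \<open>\<eta>\<close> on the space \<open>N\<close> is a version of
  \<open>x \<mapsto> P(A | X = x)\<close>, i.e. it is measurable and \<open>\<eta>(X)\<close> is a version of the conditional
  expectation of the indicator of \<open>A\<close> given the sigma-algebra generated by \<open>X\<close>.
  Such an \<open>\<eta>\<close> is determined only up to null sets of the law of \<open>X\<close>.
\<close>

definition cond_prob_fun ::
  "'a measure \<Rightarrow> 'b measure \<Rightarrow> ('a \<Rightarrow> 'b) \<Rightarrow> 'a set \<Rightarrow> ('b \<Rightarrow> real) \<Rightarrow> bool" where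
  "cond_prob_fun M N X A \<eta> \<longleftrightarrow>
     \<eta> \<in> borel_measurable N \<and>
     (AE \<omega> in M. \<eta> (X \<omega>) =
        real_cond_exp M (vimage_algebra (space M) X N) (indicator A) \<omega>)"

text \<open>Unlike the library's \<^const>\<open>sgn\<close>, this takes the value 1 at 0.\<close>

definition sign_pm :: "real \<Rightarrow> real" where
  "sign_pm t = (if t \<ge> 0 then 1 else -1)"

text \<open>
  The integrand is nonnegative for \<open>\<tau> \<in> [0,1]\<close> and \<open>Y \<in> {1,-1}\<close>, so its expectation always
  exists in \<open>[0,\<infinity>]\<close>. The nonnegative integral is used because the Bochner integral would
  assign the value 0 to an \<open>f\<close> whose loss is not integrable.
\<close>

definition asym_hinge_risk ::
  "'a measure \<Rightarrow> ('a \<Rightarrow> 'b) \<Rightarrow> ('a \<Rightarrow> real) \<Rightarrow> real \<Rightarrow> ('b \<Rightarrow> real) \<Rightarrow> ennreal" where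
  "asym_hinge_risk M X Y \<tau> f =
     (\<integral>\<^sup>+ \<omega>. ennreal (((1 + Y \<omega>) / 2 - \<tau> * Y \<omega>) * max 0 (1 - Y \<omega> * f (X \<omega>))) \<partial>M)"

text \<open>
  Competitors are measurable with respect to \<open>N\<close>, so that \<open>f(X)\<close> is a random variable that
  depends on the outcome only through \<open>X\<close>.
\<close>

definition asym_hinge_minimizer ::
  "'a measure \<Rightarrow> 'b measure \<Rightarrow> ('a \<Rightarrow> 'b) \<Rightarrow> ('a \<Rightarrow> real) \<Rightarrow> real \<Rightarrow> ('b \<Rightarrow> real) \<Rightarrow> bool" where
  "asym_hinge_minimizer M N X Y \<tau> f \<longleftrightarrow>
     is_arg_min (asym_hinge_risk M X Y \<tau>) (\<lambda>g. g \<in> borel_measurable N) f"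

end

theory Submission imports Defs begin

text \<open>
  Conditioning on \<open>X\<close> turns the risk of \<open>f\<close> into the expectation of
  \<open>(1 - \<tau>) \<eta> (1 - f)\<^sub>+ + \<tau> (1 - \<eta>) (1 + f)\<^sub>+\<close> evaluated at \<open>X\<close>. For fixed \<open>x\<close> this is a convex
  piecewise linear function of the value \<open>f x\<close> with knots \<open>\<plusminus>1\<close> and slopes
  \<open>-(1 - \<tau>) \<eta> \<le> 0\<close>, \<open>\<tau> - \<eta>\<close> and \<open>\<tau> (1 - \<eta>) \<ge> 0\<close>, so the sign of \<open>\<eta> - \<tau>\<close> minimizes it, and it is
  the only minimizer when all three slopes are nonzero.
\<close>

definition cond_hinge :: "real \<Rightarrow> real \<Rightarrow> real \<Rightarrow> real" where
  "cond_hinge \<tau> e u = (1 - \<tau>) * e * max 0 (1 - u) + \<tau> * (1 - e) * max 0 (1 + u)"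

lemma cond_hinge_nonneg:
  assumes "\<tau> \<in> {0..1}" "e \<in> {0..1}"
  shows "0 \<le> cond_hinge \<tau> e u"
  using assms unfolding cond_hinge_def by simp

text \<open>With \<open>a = (1 - \<tau>) * e\<close> and \<open>b = \<tau> * (1 - e)\<close> one has
  \<open>a - b = e - \<tau>\<close>, so the sign picks the cheaper knot and costs exactly
  \<open>2 * min a b\<close>. Any \<open>u\<close> costs at least this, since both coefficients are
  at least \<open>min a b\<close> and the two hinges add up to at least 2.\<close>

lemma cond_hinge_sign_pm_le:
  assumes "\<tau> \<in> {0..1}" "e \<in> {0..1}"
  shows "cond_hinge \<tau> e (sign_pm (e - \<tau>)) \<le> cond_hinge \<tau> e u"
proof -
  have "0 \<le> (1 - \<tau>) * e" "0 \<le> \<tau> * (1 - e)"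
    using assms by auto
  moreover have "(1 - \<tau>) * e - \<tau> * (1 - e) = e - \<tau>"
    by (simp add: algebra_simps)
  moreover have "a * max 0 (1 - sign_pm (a - b)) + b * max 0 (1 + sign_pm (a - b))
      \<le> a * max 0 (1 - u) + b * max 0 (1 + u)" if "0 \<le> a" "0 \<le> b" for a b :: real
  proof -
    have min_le: "2 * min a b \<le> min a b * (max 0 (1 - u) + max 0 (1 + u))"
      using mult_left_mono[of 2 "max 0 (1 - u) + max 0 (1 + u)" "min a b"] that
      by (auto simp: mult.commute)
    have "min a b * max 0 (1 - u) \<le> a * max 0 (1 - u)" "min a b * max 0 (1 + u) \<le> b * max 0 (1 + u)"
      by (intro mult_right_mono; simp)+
    with min_le show ?thesis
      by (auto simp: sign_pm_def distrib_left)
  qed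
  ultimately show ?thesis
    unfolding cond_hinge_def by metis
qed

text \<open>The coefficients \<open>a\<close> and \<open>b\<close> are now positive. Left of -1 the
  cost exceeds \<open>2 * a\<close>, right of 1 it exceeds \<open>2 * b\<close>, and the sign costs
  only \<open>2 * min a b\<close>. Between the knots the cost is affine with slope
  \<open>b - a\<close>, which is nonzero because \<open>e \<noteq> \<tau>\<close>.\<close>

lemma cond_hinge_minimizer_unique:
  assumes "\<tau> \<in> {0<..<1}" "e \<in> {0<..<1}" "e \<noteq> \<tau>"
    and le: "cond_hinge \<tau> e u \<le> cond_hinge \<tau> e (sign_pm (e - \<tau>))"
  shows "u = sign_pm (e - \<tau>)"
proof -
  define a b where "a = (1 - \<tau>) * e" and "b = \<tau> * (1 - e)"
  have pos: "0 < a" "0 < b"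
    using assms by (auto simp: a_def b_def)
  have diff: "a - b = e - \<tau>"
    by (simp add: a_def b_def algebra_simps)
  have le': "a * max 0 (1 - u) + b * max 0 (1 + u)
      \<le> a * max 0 (1 - sign_pm (e - \<tau>)) + b * max 0 (1 + sign_pm (e - \<tau>))"
    using le by (simp add: cond_hinge_def a_def b_def)
  consider "u < -1" | "1 < u" | "-1 \<le> u" "u \<le> 1" by linarith
  then show ?thesis
  proof cases
    case 1
    then have "a * 2 < a * (1 - u)" using pos by simp
    with le' 1 diff show ?thesis by (auto simp: sign_pm_def split: if_splits)
  next
    case 2
    then have "b * 2 < b * (1 + u)" using pos by simp
    with le' 2 diff show ?thesis by (auto simp: sign_pm_def split: if_splits)
  next
    case 3
    show ?thesis
    proof (cases "\<tau> \<le> e")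
      case True
      \<comment> \<open>The left-hand side is the excess of the cost at \<open>u\<close> over its
        value \<open>2 * b\<close> at the knot 1.\<close>
      with le' 3 have "(a - b) * (1 - u) \<le> 0"
        by (simp add: sign_pm_def algebra_simps)
      with True 3 diff assms(3) show ?thesis
        by (auto simp: sign_pm_def mult_le_0_iff)
    next
      case False
      with le' 3 have "(b - a) * (1 + u) \<le> 0"
        by (simp add: sign_pm_def algebra_simps)
      with False 3 diff show ?thesis
        by (auto simp: sign_pm_def mult_le_0_iff)
    qed
  qed
qed

text \<open>The conditional expectations of the two complementary indicators add up to that of the
  constant 1, so both are finite and lie between 0 and 1. This links the real-valued version
  defining \<open>\<eta>\<close> to the nonnegative version, which can be integrated against
  unbounded factors.\<close>

lemma (in sigma_finite_subalgebra) nn_cond_exp_indicator: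
  assumes [measurable]: "A \<in> sets M"
  shows "AE x in M. real_cond_exp M F (indicator A) x \<in> {0..1} \<and>
    nn_cond_exp M F (indicator A) x = ennreal (real_cond_exp M F (indicator A) x) \<and>
    nn_cond_exp M F (indicator (space M - A)) x = ennreal (1 - real_cond_exp M F (indicator A) x)"
proof -
  \<comment> \<open>\<open>real_cond_exp\<close> is a difference over positive and negative parts;
    the negative part of an indicator is 0, and this fact removes its contribution.\<close>
  have zero: "AE x in M. 0 = nn_cond_exp M F (\<lambda>_. 0) x"
    by (rule nn_cond_exp_F_meas) simp
  have one: "AE x in M. 1 = nn_cond_exp M F (\<lambda>_. 1) x"
    by (rule nn_cond_exp_F_meas) simp
  have sum: "AE x in M. nn_cond_exp M F (indicator A) x + nn_cond_exp M F (indicator (space M - A)) x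
      = nn_cond_exp M F (\<lambda>x. indicator A x + indicator (space M - A) x) x"
    by (rule nn_cond_exp_sum) auto
  have cong: "AE x in M. nn_cond_exp M F (\<lambda>x. indicator A x + indicator (space M - A) x) x
      = nn_cond_exp M F (\<lambda>_. 1) x"
    by (rule nn_cond_exp_cong) (auto simp: indicator_def)
  have neg: "(\<lambda>x. ennreal (- indicator A x)) = (\<lambda>_. 0)"
    by (auto simp: indicator_def ennreal_neg)
  show ?thesis
    using zero one sum cong
  proof eventually_elim
    case (elim x)
    let ?p = "nn_cond_exp M F (indicator A) x" and ?q = "nn_cond_exp M F (indicator (space M - A)) x"
    have pq: "?p + ?q = 1"
      using elim by simp
    then obtain p q where "?p = ennreal p" "0 \<le> p" "?q = ennreal q" "0 \<le> q"
      by (cases ?p; cases ?q) auto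
    moreover from this pq have "p + q = 1"
      by (simp flip: ennreal_plus)
    moreover have "real_cond_exp M F (indicator A) x = enn2real ?p"
      using elim(1) by (simp add: real_cond_exp_def neg ennreal_indicator)
    ultimately show ?case
      by (auto simp: algebra_simps)
  qed
qed

context
  fixes M :: "'a measure" and N :: "'b measure"
    and X :: "'a \<Rightarrow> 'b" and A :: "'a set" and \<eta> :: "'b \<Rightarrow> real"
  assumes M: "prob_space M"
    and X [measurable]: "X \<in> measurable M N"
    and A [measurable]: "A \<in> sets M"
    and \<eta>: "cond_prob_fun M N X A \<eta>"
begin

lemma sigma_finite_subalgebra_vimage:
  "sigma_finite_subalgebra M (vimage_algebra (space M) X N)"
proof (rule finite_measure_subalgebra_is_sigma_finite)
  interpret prob_space M by (fact M)
  show "finite_measure_subalgebra M (vimage_algebra (space M) X N)"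
    by unfold_locales (simp add: subalgebra_def sets_image_in_sets[OF refl X])
qed

lemma cond_prob_fun_AE_bounds: "AE \<omega> in M. \<eta> (X \<omega>) \<in> {0..1}"
  using sigma_finite_subalgebra.nn_cond_exp_indicator[OF sigma_finite_subalgebra_vimage A] \<eta>
  unfolding cond_prob_fun_def by auto

text \<open>Tower property: \<open>g\<close> and \<open>h\<close> composed with \<open>X\<close> are
  measurable for the sigma-algebra generated by \<open>X\<close>, so each indicator may be replaced
  by its conditional expectation. Values in \<open>ennreal\<close> cover infinite risks as
  well.\<close>

lemma nn_integral_cond_prob_fun:
  assumes [measurable]: "g \<in> borel_measurable N" "h \<in> borel_measurable N"
  shows "(\<integral>\<^sup>+ \<omega>. (g (X \<omega>) * indicator A \<omega> + h (X \<omega>) * indicator (space M - A) \<omega>) \<partial>M) =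
    (\<integral>\<^sup>+ \<omega>. (g (X \<omega>) * ennreal (\<eta> (X \<omega>)) + h (X \<omega>) * ennreal (1 - \<eta> (X \<omega>))) \<partial>M)"
proof -
  define F where "F = vimage_algebra (space M) X N"
  interpret sigma_finite_subalgebra M F
    unfolding F_def by (rule sigma_finite_subalgebra_vimage)
  have [measurable]: "\<eta> \<in> borel_measurable N"
    using \<eta> by (simp add: cond_prob_fun_def)
  have XF [measurable]: "X \<in> measurable F N"
    unfolding F_def using X by (intro measurable_vimage_algebra1) (auto dest: measurable_space[OF X])
  have ae: "AE \<omega> in M. nn_cond_exp M F (indicator A) \<omega> = ennreal (\<eta> (X \<omega>)) \<and>
      nn_cond_exp M F (indicator (space M - A)) \<omega> = ennreal (1 - \<eta> (X \<omega>))"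
    using nn_cond_exp_indicator[OF A] \<eta> unfolding cond_prob_fun_def F_def[symmetric] by auto
  have "(\<integral>\<^sup>+ \<omega>. (g (X \<omega>) * indicator A \<omega> + h (X \<omega>) * indicator (space M - A) \<omega>) \<partial>M) =
      (\<integral>\<^sup>+ \<omega>. g (X \<omega>) * indicator A \<omega> \<partial>M) + (\<integral>\<^sup>+ \<omega>. h (X \<omega>) * indicator (space M - A) \<omega> \<partial>M)"
    by (rule nn_integral_add) measurable
  also have "\<dots> = (\<integral>\<^sup>+ \<omega>. g (X \<omega>) * nn_cond_exp M F (indicator A) \<omega> \<partial>M) +
      (\<integral>\<^sup>+ \<omega>. h (X \<omega>) * nn_cond_exp M F (indicator (space M - A)) \<omega> \<partial>M)"
    by (subst (1 2) nn_cond_exp_intg) auto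
  also have "\<dots> = (\<integral>\<^sup>+ \<omega>. g (X \<omega>) * ennreal (\<eta> (X \<omega>)) \<partial>M) +
      (\<integral>\<^sup>+ \<omega>. h (X \<omega>) * ennreal (1 - \<eta> (X \<omega>)) \<partial>M)"
    by (intro arg_cong2[where f="(+)"] nn_integral_cong_AE) (use ae in auto)
  also have "\<dots> = (\<integral>\<^sup>+ \<omega>. (g (X \<omega>) * ennreal (\<eta> (X \<omega>)) + h (X \<omega>) * ennreal (1 - \<eta> (X \<omega>))) \<partial>M)"
    by (rule nn_integral_add[symmetric]) measurable
  finally show ?thesis .
qed

text \<open>On \<open>A\<close> the label is 1 and the loss is that of \<open>g\<close>; off
  \<open>A\<close> it is -1 and the loss is that of \<open>h\<close>. Conditioning on
  \<open>X\<close> then turns the two indicators into \<open>\<eta>\<close> and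
  \<open>1 - \<eta>\<close>.\<close>

lemma asym_hinge_risk_eq:
  assumes Y: "\<And>\<omega>. \<omega> \<in> space M \<Longrightarrow> Y \<omega> \<in> {1, -1}" "A = {\<omega> \<in> space M. Y \<omega> = 1}"
    and \<tau>: "\<tau> \<in> {0..1}" and [measurable]: "f \<in> borel_measurable N"
  shows "asym_hinge_risk M X Y \<tau> f = (\<integral>\<^sup>+ \<omega>. ennreal (cond_hinge \<tau> (\<eta> (X \<omega>)) (f (X \<omega>))) \<partial>M)"
proof -
  define g h where "g = (\<lambda>x. ennreal ((1 - \<tau>) * max 0 (1 - f x)))"
    and "h = (\<lambda>x. ennreal (\<tau> * max 0 (1 + f x)))"
  have "asym_hinge_risk M X Y \<tau> f =
      (\<integral>\<^sup>+ \<omega>. (g (X \<omega>) * indicator A \<omega> + h (X \<omega>) * indicator (space M - A) \<omega>) \<partial>M)"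
    unfolding asym_hinge_risk_def
  proof (rule nn_integral_cong)
    fix \<omega> assume "\<omega> \<in> space M"
    with Y(1)[of \<omega>] show "ennreal (((1 + Y \<omega>) / 2 - \<tau> * Y \<omega>) * max 0 (1 - Y \<omega> * f (X \<omega>))) =
        g (X \<omega>) * indicator A \<omega> + h (X \<omega>) * indicator (space M - A) \<omega>"
      by (auto simp: g_def h_def Y(2))
  qed
  also have "\<dots> = (\<integral>\<^sup>+ \<omega>. (g (X \<omega>) * ennreal (\<eta> (X \<omega>)) + h (X \<omega>) * ennreal (1 - \<eta> (X \<omega>))) \<partial>M)"
    by (rule nn_integral_cond_prob_fun) (simp_all add: g_def h_def)
  also have "\<dots> = (\<integral>\<^sup>+ \<omega>. ennreal (cond_hinge \<tau> (\<eta> (X \<omega>)) (f (X \<omega>))) \<partial>M)"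
  proof (rule nn_integral_cong_AE)
    show "AE \<omega> in M. g (X \<omega>) * ennreal (\<eta> (X \<omega>)) + h (X \<omega>) * ennreal (1 - \<eta> (X \<omega>)) =
        ennreal (cond_hinge \<tau> (\<eta> (X \<omega>)) (f (X \<omega>)))"
      \<comment> \<open>Since \<open>ennreal\<close> sends negative reals to 0, it respects these
        products and sums only where \<open>\<eta> (X \<omega>)\<close> lies in the unit interval,
        which holds almost everywhere.\<close>
      using cond_prob_fun_AE_bounds
    proof eventually_elim
      case (elim \<omega>)
      with \<tau> show ?case
        by (simp add: g_def h_def cond_hinge_def ac_simps flip: ennreal_mult ennreal_plus)
    qed
  qed
  finally show ?thesis .
qed

end

text \<open>Uniqueness is claimed only where the pointwise problem has a single solution. For
  \<open>0 < \<tau> < 1\<close>, every value in \<open>[-1, 1]\<close> is optimal where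
  \<open>\<eta> x = \<tau>\<close>, every value below -1 where \<open>\<eta> x = 0\<close>, and
  every value above 1 where \<open>\<eta> x = 1\<close>; for \<open>\<tau>\<close> equal to 0 or 1 a
  half-line of values is optimal as well.\<close>

theorem lemma2p2:
  fixes M :: "'a measure" and N :: "'b measure"
    and X :: "'a \<Rightarrow> 'b" and Y :: "'a \<Rightarrow> real"
    and \<eta> :: "'b \<Rightarrow> real" and \<tau> :: real
  assumes "prob_space M"
    and "X \<in> measurable M N"
    and "Y \<in> borel_measurable M"
    and "\<And>\<omega>. \<omega> \<in> space M \<Longrightarrow> Y \<omega> \<in> {1, -1}"
    and "cond_prob_fun M N X {\<omega> \<in> space M. Y \<omega> = 1} \<eta>"
    and "\<tau> \<in> {0..1}"
  shows "asym_hinge_minimizer M N X Y \<tau> (\<lambda>x. sign_pm (\<eta> x - \<tau>)) \<and>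
    (\<forall>f. asym_hinge_minimizer M N X Y \<tau> f \<longrightarrow>
       (AE x in distr M N X.
          \<tau> \<in> {0<..<1} \<and> \<eta> x \<in> {0<..<1} \<and> \<eta> x \<noteq> \<tau> \<longrightarrow> f x = sign_pm (\<eta> x - \<tau>)))"
proof (intro conjI allI impI)
  interpret prob_space M by (fact assms(1))
  define s where "s = (\<lambda>x. sign_pm (\<eta> x - \<tau>))"
  note [measurable] = assms(2,3)
  have A [measurable]: "{\<omega> \<in> space M. Y \<omega> = 1} \<in> sets M"
    by measurable
  have \<eta> [measurable]: "\<eta> \<in> borel_measurable N"
    using assms(5) by (simp add: cond_prob_fun_def)
  have s [measurable]: "s \<in> borel_measurable N"
    unfolding s_def sign_pm_def by measurable
  note bounds = cond_prob_fun_AE_bounds[OF assms(1,2) A assms(5)]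
  have risk: "asym_hinge_risk M X Y \<tau> f = (\<integral>\<^sup>+ \<omega>. ennreal (cond_hinge \<tau> (\<eta> (X \<omega>)) (f (X \<omega>))) \<partial>M)"
    if "f \<in> borel_measurable N" for f
    by (rule asym_hinge_risk_eq[OF assms(1,2) A assms(5) _ refl assms(6) that]) (fact assms(4))
  have le: "AE \<omega> in M. ennreal (cond_hinge \<tau> (\<eta> (X \<omega>)) (s (X \<omega>)))
      \<le> ennreal (cond_hinge \<tau> (\<eta> (X \<omega>)) (f (X \<omega>)))" for f
    using bounds
    by eventually_elim (simp add: s_def ennreal_leI cond_hinge_sign_pm_le[OF assms(6)])
  have risk_le: "asym_hinge_risk M X Y \<tau> s \<le> asym_hinge_risk M X Y \<tau> f"
    if [measurable]: "f \<in> borel_measurable N" for f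
    unfolding risk[OF s] risk[OF that] by (intro nn_integral_mono_AE le)
  then show "asym_hinge_minimizer M N X Y \<tau> (\<lambda>x. sign_pm (\<eta> x - \<tau>))"
    using s unfolding asym_hinge_minimizer_def is_arg_min_def s_def by (auto simp: not_less)
  fix f assume "asym_hinge_minimizer M N X Y \<tau> f"
  then have f [measurable]: "f \<in> borel_measurable N"
    and not_less: "\<not> asym_hinge_risk M X Y \<tau> s < asym_hinge_risk M X Y \<tau> f"
    using s by (auto simp: asym_hinge_minimizer_def is_arg_min_def)
  \<comment> \<open>The zero function has loss equal to the weight, which is at most 1. Hence the
    minimal risk is finite, as needed to pass from equal integrals to integrands equal almost
    everywhere.\<close>
  have "asym_hinge_risk M X Y \<tau> s \<le> asym_hinge_risk M X Y \<tau> (\<lambda>_. 0)"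
    by (rule risk_le) simp
  also have "\<dots> \<le> (\<integral>\<^sup>+ \<omega>. 1 \<partial>M)"
    unfolding asym_hinge_risk_def
    by (rule nn_integral_mono) (use assms(4,6) in \<open>fastforce simp: field_simps\<close>)
  also have "\<dots> < \<infinity>"
    by (simp add: emeasure_space_1)
  finally have "(\<integral>\<^sup>+ \<omega>. ennreal (cond_hinge \<tau> (\<eta> (X \<omega>)) (s (X \<omega>))) \<partial>M) \<noteq> \<infinity>"
    by (simp add: risk)
  \<comment> \<open>The integrand of \<open>s\<close> is the smaller one almost everywhere. If the
    reverse inequality failed on a set of positive measure, \<open>nn_integral_less\<close> would
    make the risk of \<open>s\<close> strictly smaller, contradicting the minimality of
    \<open>f\<close>.\<close>
  then have ge: "AE \<omega> in M. ennreal (cond_hinge \<tau> (\<eta> (X \<omega>)) (f (X \<omega>)))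
      \<le> ennreal (cond_hinge \<tau> (\<eta> (X \<omega>)) (s (X \<omega>)))"
    using not_less nn_integral_less[OF _ _ _ le[of f]] unfolding risk[OF s] risk[OF f]
    by (auto simp: cond_hinge_def)
  have "AE \<omega> in M. \<tau> \<in> {0<..<1} \<and> \<eta> (X \<omega>) \<in> {0<..<1} \<and> \<eta> (X \<omega>) \<noteq> \<tau> \<longrightarrow> f (X \<omega>) = s (X \<omega>)"
    using ge bounds
  proof eventually_elim
    case (elim \<omega>)
    then show ?case
      using cond_hinge_minimizer_unique[of \<tau> "\<eta> (X \<omega>)" "f (X \<omega>)"] assms(6)
      by (simp add: s_def ennreal_le_iff cond_hinge_nonneg)
  qed
  then have "AE x in distr M N X. \<tau> \<in> {0<..<1} \<and> \<eta> x \<in> {0<..<1} \<and> \<eta> x \<noteq> \<tau> \<longrightarrow> f x = s x"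
    by (subst AE_distr_iff) auto
  then show "AE x in distr M N X.
      \<tau> \<in> {0<..<1} \<and> \<eta> x \<in> {0<..<1} \<and> \<eta> x \<noteq> \<tau> \<longrightarrow> f x = sign_pm (\<eta> x - \<tau>)"
    by (simp add: s_def)
qed

end
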